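(* Let $d\neq d'$ be integers, $\delta=|d-d'|$, and let $G:[0,1]\times S^1\to\mathbb C=\mathbb R^2$ be $G(t,z)=(1-t)z^d+tz^{d'}$, where $S^1=\{z\in\mathbb C:|z|=1\}$. (i) $G(t,z)=0$ can only occur for $t=\tfrac12$, and $G(\tfrac12,z)=0$ if and only if $z^{\delta}=-1$; thus the critical curve $g(z)=G(\tfrac12,z)=\tfrac12(z^d+z^{d'})$ passes through the origin at exactly $\delta$ parameter values $z=\exp\!\big(i\tfrac{2\pi}{2\delta}(2j+1)\big)$, $j=0,\dots,\delta-1$. (ii) For $z=e^{i\phi}$, $\phi\in[0,2\pi]$, one has $$g(e^{i\phi})=\Big(\cos\big(\tfrac{d-d'}{2}\phi\big)\cos\big(\tfrac{d+d'}{2}\phi\big),\ \cos\big(\tfrac{d-d'}{2}\phi\big)\sin\big(\tfrac{d+d'}{2}\phi\big)\Big).$$ If $d\neq -d'$, then the critical curve is part of a rose curve: it satisfies the polar equation $r=\cos(k\theta)$ with $k=\left|\frac{d-d'}{d+d'}\right|$, where $\theta=\frac{d+d'}{2}\phi$. If $d=-d'$, the curve is $\phi\mapsto(\cos(d\phi),0)$.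
   Context: The polar equation $r=\cos(k\theta)$ is understood with signed radius, i.e. it describes the points $(r\cos\theta,r\sin\theta)$ with $r=\cos(k\theta)$. *)

theory Defs
  imports "HOL-Analysis.Analysis"
begin

text \<open>The plane is identified with the complex numbers. The homotopy is a total function here; it
  is only considered for \<open>t \<in> {0..1}\<close> and \<open>z \<in> sphere 0 1\<close>. The exponents are integers, hence the
  use of \<open>powi\<close>.\<close>

definition homotopy_G :: "int \<Rightarrow> int \<Rightarrow> real \<Rightarrow> complex \<Rightarrow> complex" where
  "homotopy_G d d' t z = of_real (1 - t) * z powi d + of_real t * z powi d'"

definition critical_curve :: "int \<Rightarrow> int \<Rightarrow> complex \<Rightarrow> complex" where
  "critical_curve d d' z = homotopy_G d d' (1/2) z"

text \<open>The radius is signed: \<open>r\<close> may be negative. The angle ranges over all of \<open>\<real>\<close>, because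
  \<open>cos (k * \<theta>)\<close> need not have period \<open>2 * pi\<close> when \<open>k\<close> is not an integer.\<close>

definition polar_point :: "real \<Rightarrow> real \<Rightarrow> complex" where
  "polar_point r \<theta> = Complex (r * cos \<theta>) (r * sin \<theta>)"

definition rose_curve :: "real \<Rightarrow> complex set" where
  "rose_curve k = {polar_point r \<theta> | r \<theta>. r = cos (k * \<theta>)}"

end

theory Submission
  imports Defs
begin

text \<open>On the unit circle the two terms of \<open>homotopy_G\<close> have moduli
  \<open>1 - t\<close> and \<open>t\<close>, so they can cancel only at \<open>t = 1/2\<close>.
  There, factoring out the smaller power of \<open>z\<close> turns vanishing into
  \<open>z ^ \<delta> = -1\<close>, and the \<delta>-th roots of -1 are the \<delta>-th roots of
  unity rotated by \<open>pi / \<delta>\<close>. For the shape of the curve, the sum-to-product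
  formulas applied to real and imaginary part of \<open>cis (d * \<phi>) + cis (d' * \<phi>)\<close>
  produce a common factor \<open>cos ((d - d') / 2 * \<phi>)\<close>, the signed radius, times the
  unit vector at angle \<theta> = \<open>(d + d') / 2 * \<phi>\<close>
  (\<open>critical_curve_cis\<close>). If \<open>d + d'\<close> is nonzero, the radius can be
  rewritten in terms of \<theta>, which gives the rose; if it is zero, the angle is constantly
  0.\<close>

lemma power_int_add_eq_0_iff:
  fixes z :: "'a :: field"
  assumes "z \<noteq> 0"
  shows "z powi m + z powi n = 0 \<longleftrightarrow> z ^ nat \<bar>m - n\<bar> = -1"
proof -
  \<comment> \<open>The claim is symmetric in \<open>m\<close> and \<open>n\<close>, so it suffices
    to treat a nonnegative exponent difference.\<close>
  have *: "z powi m + z powi n = 0 \<longleftrightarrow> z ^ nat (m - n) = -1" if "n \<le> m" for m n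
  proof -
    have "z powi m = z powi n * z ^ nat (m - n)"
      using assms that power_int_add[of z n "m - n"] by (simp add: power_int_def)
    then have "z powi m + z powi n = z powi n * (z ^ nat (m - n) + 1)"
      by (simp add: algebra_simps)
    then show ?thesis
      using assms by (simp add: eq_neg_iff_add_eq_0)
  qed
  show ?thesis
  proof (cases "n \<le> m")
    case True
    then show ?thesis using *[of n m] by simp
  next
    case False
    then show ?thesis using *[of m n] by (simp add: add.commute)
  qed
qed

lemma homotopy_G_zero_imp_half:
  assumes "t \<in> {0..1}" "norm z = 1" "homotopy_G d d' t z = 0"
  shows "t = 1/2"
proof -
  have "of_real (1 - t) * z powi d = - (of_real t * z powi d')"
    using assms(3) unfolding homotopy_G_def by (simp add: eq_neg_iff_add_eq_0)
  then have "norm (of_real (1 - t) * z powi d) = norm (of_real t * z powi d')"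
    by (simp only: norm_minus_cancel)
  then have "\<bar>1 - t\<bar> = \<bar>t\<bar>"
    using assms(2) by (simp only: norm_mult norm_power_int norm_of_real power_int_1_left mult_1_right)
  then show ?thesis
    using assms(1) by simp
qed

lemma critical_curve_eq: "critical_curve d d' z = 1/2 * (z powi d + z powi d')"
  by (simp add: critical_curve_def homotopy_G_def algebra_simps)

lemma critical_curve_eq_0_iff:
  assumes "norm z = 1"
  shows "critical_curve d d' z = 0 \<longleftrightarrow> z ^ nat \<bar>d - d'\<bar> = -1"
proof -
  have "z \<noteq> 0"
    using assms by auto
  then show ?thesis
    by (simp add: critical_curve_eq power_int_add_eq_0_iff)
qed

text \<open>Multiplying the root of unity of angle \<open>2 * pi * j / n\<close> by the particular
  root \<open>cis (pi / n)\<close> of -1 adds the angles to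
  \<open>(2 * j + 1) * pi / n\<close>.\<close>

lemma bij_betw_roots_minus_one:
  assumes "n > 0"
  shows "bij_betw (\<lambda>j. cis (2 * pi / (2 * real n) * (2 * real j + 1))) {..<n} {z. z ^ n = -1}"
proof -
  have "Arg (-1) = pi"
    by (rule cis_Arg_unique) (simp_all add: sgn_eq)
  then have "bij_betw (\<lambda>z. cis (pi / n) * z) {z. z ^ n = 1} {z. z ^ n = -1}"
    using bij_betw_nth_root_unity[of "-1" n] assms by simp
  from bij_betw_trans[OF Complex.bij_betw_roots_unity[OF assms] this]
  show ?thesis
    by (rule bij_betw_cong[THEN iffD1, rotated])
      (use assms in \<open>simp add: cis_mult field_simps\<close>)
qed

lemma critical_curve_cis:
  "critical_curve d d' (cis \<phi>) =
    polar_point (cos (real_of_int (d - d') / 2 * \<phi>)) (real_of_int (d + d') / 2 * \<phi>)"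
proof -
  have sum: "(real_of_int d * \<phi> + real_of_int d' * \<phi>) / 2 = real_of_int (d + d') / 2 * \<phi>"
    by (simp add: ring_distribs)
  have diff: "(real_of_int d * \<phi> - real_of_int d' * \<phi>) / 2 = real_of_int (d - d') / 2 * \<phi>"
    by (simp add: left_diff_distrib)
  show ?thesis
    unfolding critical_curve_eq cis_power_int polar_point_def complex_eq_iff
    using cos_plus_cos[of "real_of_int d * \<phi>" "real_of_int d' * \<phi>", unfolded sum diff]
      sin_plus_sin[of "real_of_int d * \<phi>" "real_of_int d' * \<phi>", unfolded sum diff]
    \<comment> \<open>\<open>d + d'\<close> and \<open>d - d'\<close> must stay inside
      \<open>real_of_int\<close> to match the rewritten formulas.\<close>
    by (simp del: of_int_add of_int_diff)
qed

lemma critical_curve_cis_rose: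
  fixes d d' :: int
  assumes "d \<noteq> - d'"
  defines "k \<equiv> \<bar>real_of_int (d - d') / real_of_int (d + d')\<bar>"
  shows "critical_curve d d' (cis \<phi>) =
    polar_point (cos (k * (real_of_int (d + d') / 2 * \<phi>))) (real_of_int (d + d') / 2 * \<phi>)"
proof -
  have nz: "real_of_int (d + d') \<noteq> 0"
    using assms(1) by linarith
  \<comment> \<open>The absolute value in \<open>k\<close> may flip the sign of the argument; this
    is harmless because cosine is even.\<close>
  have "\<bar>k * (real_of_int (d + d') / 2 * \<phi>)\<bar> = \<bar>real_of_int (d - d') / 2 * \<phi>\<bar>"
    using nz unfolding k_def abs_mult abs_divide abs_abs by simp
  then have "cos (k * (real_of_int (d + d') / 2 * \<phi>)) = cos (real_of_int (d - d') / 2 * \<phi>)"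
    by (metis cos_abs_real)
  then show ?thesis
    by (simp only: critical_curve_cis)
qed

lemma critical_curve_subset_rose:
  assumes "d \<noteq> - d'"
  shows "critical_curve d d' ` sphere 0 1
    \<subseteq> rose_curve \<bar>real_of_int (d - d') / real_of_int (d + d')\<bar>"
proof clarify
  fix z :: complex
  assume "z \<in> sphere 0 1"
  \<comment> \<open>\<open>Arg\<close> takes values in \<open>(-pi, pi]\<close> rather than
    \<open>[0, 2 * pi]\<close>, but \<open>critical_curve_cis_rose\<close> holds for every real
    angle.\<close>
  then have "z = cis (Arg z)"
    by (subst cis_Arg) (auto simp: sgn_eq)
  then have "critical_curve d d' z = critical_curve d d' (cis (Arg z))"
    by simp
  then show "critical_curve d d' z
      \<in> rose_curve \<bar>real_of_int (d - d') / real_of_int (d + d')\<bar>"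
    unfolding rose_curve_def critical_curve_cis_rose[OF assms] by blast
qed

theorem mainTheorem4:
  fixes d d' :: int and \<delta> :: nat
  assumes "d \<noteq> d'" and "\<delta> = nat \<bar>d - d'\<bar>"
  shows
    "(\<forall>t\<in>{0..1}. \<forall>z\<in>sphere 0 1. homotopy_G d d' t z = 0 \<longrightarrow> t = 1/2)
     \<and> (\<forall>z\<in>sphere 0 1. homotopy_G d d' (1/2) z = 0 \<longleftrightarrow> z ^ \<delta> = -1)
     \<and> (\<forall>z\<in>sphere 0 1. critical_curve d d' z = 1/2 * (z powi d + z powi d'))
     \<and> {z \<in> sphere 0 1. critical_curve d d' z = 0} =
         (\<lambda>j. exp (\<i> * of_real (2 * pi / (2 * real \<delta>) * (2 * real j + 1)))) ` {..<\<delta>}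
     \<and> card {z \<in> sphere 0 1. critical_curve d d' z = 0} = \<delta>
     \<and> (\<forall>\<phi>\<in>{0..2 * pi}. critical_curve d d' (exp (\<i> * of_real \<phi>)) =
          Complex (cos (real_of_int (d - d') / 2 * \<phi>) * cos (real_of_int (d + d') / 2 * \<phi>))
                  (cos (real_of_int (d - d') / 2 * \<phi>) * sin (real_of_int (d + d') / 2 * \<phi>)))
     \<and> (d \<noteq> - d' \<longrightarrow>
          (let k = \<bar>real_of_int (d - d') / real_of_int (d + d')\<bar> in
             critical_curve d d' ` sphere 0 1 \<subseteq> rose_curve k
             \<and> (\<forall>\<phi>\<in>{0..2 * pi}.
                  let \<theta> = real_of_int (d + d') / 2 * \<phi> in
                  critical_curve d d' (exp (\<i> * of_real \<phi>)) = polar_point (cos (k * \<theta>)) \<theta>)))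
     \<and> (d = - d' \<longrightarrow>
          (\<forall>\<phi>\<in>{0..2 * pi}. critical_curve d d' (exp (\<i> * of_real \<phi>)) =
             Complex (cos (real_of_int d * \<phi>)) 0))"
proof -
  have \<delta>: "\<delta> > 0"
    using assms by simp
  have zeros: "{z \<in> sphere 0 1. critical_curve d d' z = 0} = {z. z ^ \<delta> = -1}"
  proof -
    have "norm z = 1" if "z ^ \<delta> = -1" for z :: complex
    proof -
      have "norm z ^ \<delta> = 1"
        using that by (metis norm_power norm_minus_cancel norm_one)
      then show ?thesis
        using \<delta> power_eq_imp_eq_base[of "norm z" \<delta> 1] by simp
    qed
    then show ?thesis
      using critical_curve_eq_0_iff[of _ d d'] unfolding assms(2) by auto
  qed
  show ?thesis
    unfolding zeros Let_def cis_conv_exp[symmetric]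
  proof (intro conjI impI ballI)
    show "t = 1/2" if "t \<in> {0..1}" "z \<in> sphere 0 1" "homotopy_G d d' t z = 0" for t z
      using that by (intro homotopy_G_zero_imp_half[of t z d d']) auto
    show "homotopy_G d d' (1/2) z = 0 \<longleftrightarrow> z ^ \<delta> = -1" if "z \<in> sphere 0 1" for z
      using that by (simp add: assms(2) critical_curve_eq_0_iff flip: critical_curve_def)
    show "critical_curve d d' z = 1/2 * (z powi d + z powi d')" for z
      by (rule critical_curve_eq)
    show "{z. z ^ \<delta> = -1} =
        (\<lambda>j. cis (2 * pi / (2 * real \<delta>) * (2 * real j + 1))) ` {..<\<delta>}"
      using bij_betw_imp_surj_on[OF bij_betw_roots_minus_one[OF \<delta>]] by (rule sym)
    show "card {z :: complex. z ^ \<delta> = -1} = \<delta>"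
      using \<delta> by (intro card_nth_roots) simp_all
    show "critical_curve d d' (cis \<phi>) =
        Complex (cos (real_of_int (d - d') / 2 * \<phi>) * cos (real_of_int (d + d') / 2 * \<phi>))
          (cos (real_of_int (d - d') / 2 * \<phi>) * sin (real_of_int (d + d') / 2 * \<phi>))" for \<phi>
      by (rule critical_curve_cis[unfolded polar_point_def])
    \<comment> \<open>Here \<open>d - d' = 2 * d\<close> and \<open>d + d' = 0\<close>, so the polar
      angle is 0 and only the signed radius remains.\<close>
    show "critical_curve d d' (cis \<phi>) = Complex (cos (real_of_int d * \<phi>)) 0"
      if "d = - d'" for \<phi>
      using that by (simp add: critical_curve_cis polar_point_def)
  qed (rule critical_curve_subset_rose critical_curve_cis_rose, assumption)+
qed

end
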